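(* Every path-connected Tychonoff space $X$ is $\kappa$-sequential.
   Context: All topological spaces are assumed to be Tychonoff. A space $X$ is $\kappa$-sequential if for every non-closed open subset $W$ of $X$ there are a point $z\in\overline{W}\setminus W$ and a sequence $\{x_n\}_{n\in\omega}\subseteq W$ converging to $z$. *)

theory Defs
  imports "HOL-Analysis.Analysis"
begin

definition Tychonoff_space :: "'a topology \<Rightarrow> bool" where
  "Tychonoff_space X \<longleftrightarrow> completely_regular_space X \<and> t1_space X"

definition kappa_sequential_space :: "'a topology \<Rightarrow> bool" where
  "kappa_sequential_space X \<longleftrightarrow>
     (\<forall>W. openin X W \<and> \<not> closedin X W \<longrightarrow>
        (\<exists>z \<in> X closure_of W - W. \<exists>x :: nat \<Rightarrow> 'a.
           (\<forall>n. x n \<in> W) \<and> limitin X x z sequentially))"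

end

theory Submission
  imports Defs
begin

text \<open>A path that starts in \<open>W\<close> and ends outside it pulls \<open>W\<close> back to a relatively open subset of
  the connected interval \<open>[0, 1]\<close> that is not closed. A sequence witnessing this non-closedness is
  mapped by the path to the required sequence in \<open>W\<close>.\<close>

lemma path_connected_space_imp_kappa_sequential:
  assumes X: "path_connected_space X"
  shows "kappa_sequential_space X"
  unfolding kappa_sequential_space_def
proof (intro allI impI, elim conjE)
  fix W
  assume W: "openin X W" and "\<not> closedin X W"
  \<comment> \<open>The empty set and the whole space are closed, so \<open>W\<close> is
    neither.\<close>
  then have "W \<noteq> {}" "W \<noteq> topspace X" "W \<subseteq> topspace X"
    using openin_subset by auto
  then obtain w p where "w \<in> W" "w \<in> topspace X" "p \<in> topspace X" "p \<notin> W"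
    by blast
  then obtain g where g: "pathin X g" and g0: "g 0 \<in> W" and g1: "g 1 \<notin> W"
    using X unfolding path_connected_space_def by metis
  define V where "V = {t \<in> {0..1}. g t \<in> W}"
  have cont: "continuous_map (top_of_set {0..1}) X g"
    using g by (simp add: pathin_def)
  have "openin (top_of_set {0..1}) V"
    using openin_continuous_map_preimage[OF cont W] by (simp add: V_def)
  moreover have "0 \<in> V" "1 \<notin> V"
    using g0 g1 by (auto simp: V_def)
  \<comment> \<open>A clopen subset of the connected interval is empty or everything; the two
    endpoints exclude both.\<close>
  ultimately have "\<not> closedin (top_of_set {0..1}) V"
    using connected_clopen[of "{0..1::real}"] by (metis atLeastAtMost_iff connected_Icc
        empty_iff order_refl zero_le_one)
  \<comment> \<open>Since \<open>V\<close> lies in the interval, closedness in the real line, where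
    sequences detect it, would give relative closedness.\<close>
  then have "\<not> closed V"
    by (metis (no_types, lifting) V_def closed_subset mem_Collect_eq subsetI)
  then obtain s t where s: "\<And>n. s n \<in> V" and lim: "s \<longlonglongrightarrow> t" and t: "t \<notin> V"
    unfolding closed_sequential_limits by blast
  have s01: "s n \<in> {0..1}" for n
    using s by (simp add: V_def)
  \<comment> \<open>The interval is closed, so \<open>t\<close> stays in the domain of the path and
    \<open>t \<notin> V\<close> can only mean \<open>g t \<notin> W\<close>.\<close>
  then have t01: "t \<in> {0..1}"
    using closed_sequentially[OF closed_atLeastAtMost _ lim] by blast
  then have "limitin (top_of_set {0..1}) s t sequentially"
    using lim s01 by (simp add: limitin_subtopology)
  then have limg: "limitin X (g \<circ> s) (g t) sequentially"
    by (rule continuous_map_limit[OF cont])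
  have sW: "(g \<circ> s) n \<in> W" for n
    using s by (simp add: V_def)
  \<comment> \<open>The closure is a closed set containing every term of \<open>g \<circ> s\<close>,
    hence also the limit.\<close>
  have "g t \<in> X closure_of W"
    by (rule limitin_closedin[OF limg closedin_closure_of])
      (use sW closure_of_subset[OF openin_subset[OF W]] in \<open>auto intro!: always_eventually\<close>)
  moreover have "g t \<notin> W"
    using t t01 by (simp add: V_def)
  ultimately show "\<exists>z \<in> X closure_of W - W. \<exists>x :: nat \<Rightarrow> 'a.
      (\<forall>n. x n \<in> W) \<and> limitin X x z sequentially"
    using limg sW by blast
qed

theorem proposition2p9:
  fixes X :: "'a topology"
  assumes "Tychonoff_space X" and "path_connected_space X"
  shows "kappa_sequential_space X"
  using assms(2) by (rule path_connected_space_imp_kappa_sequential)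

end
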